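(* Let $n \in \mathbb{Z}^+$ be such that $n = pq$ is a non-square semiprime, where $p < q$ are the prime factors of $n$. Define $$\omega = \left\lfloor \frac{(n^{2n} + 1)^{2n+1} \bmod (n^{4n}-n)}{(n^{2n} + 1)^{2n} \bmod (n^{4n}-n)} \right\rfloor - 1 ,$$ and set $$\gamma = \left\lfloor \frac{(\omega+1)^{\omega(\omega+2)}}{\left\lfloor \dfrac{\left( (\omega+1)^{\omega(\omega+2)} + 1 \right)^{(\omega+1)^{\omega+2}}}{(\omega+1)^{\omega^2(\omega+2)}} \right\rfloor \bmod (\omega+1)^{\omega(\omega+2)}} \right\rfloor .$$ Then $$p = \left\lfloor \frac{n^{n+n(\gamma \bmod n)}}{(n^n-1)(n^{\gamma \bmod n}-1)} \right\rfloor \bmod n .$$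
   Context: A semiprime is a product of exactly two primes; it is non-square if the two primes are distinct. $\lfloor\cdot\rfloor$ is the floor of a rational number. For an integer $u$ and a positive integer $m$, $u \bmod m$ denotes the least non-negative remainder, $u \bmod m = u - m\lfloor u/m\rfloor$. In the definition of $\gamma$, the outer denominator is the quantity (inner floor) $\bmod\ (\omega+1)^{\omega(\omega+2)}$. *)

theory Defs
  imports Complex_Main "HOL-Computational_Algebra.Primes"
begin

text \<open>
  Division below is division of rationals, followed by an explicit floor. Exponents computed
  from \<open>\<omega>\<close> and \<open>\<gamma>\<close> are coerced by \<open>nat\<close>. This truncates nothing for the
  relevant \<open>n\<close>: there \<open>\<omega> = \<lfloor>\<surd>n\<rfloor>\<close>, and a remainder modulo \<open>n > 0\<close> is
  non-negative.
\<close>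

definition omega :: "nat \<Rightarrow> int" where
  "omega n =
     \<lfloor>rat_of_int ((int n ^ (2*n) + 1) ^ (2*n + 1) mod (int n ^ (4*n) - int n)) /
      rat_of_int ((int n ^ (2*n) + 1) ^ (2*n) mod (int n ^ (4*n) - int n))\<rfloor> - 1"

definition gamma :: "int \<Rightarrow> int" where
  "gamma \<omega> =
     \<lfloor>rat_of_int ((\<omega> + 1) ^ nat (\<omega> * (\<omega> + 2))) /
      rat_of_int
        (\<lfloor>rat_of_int (((\<omega> + 1) ^ nat (\<omega> * (\<omega> + 2)) + 1) ^ nat ((\<omega> + 1) ^ nat (\<omega> + 2))) /
          rat_of_int ((\<omega> + 1) ^ nat (\<omega>\<^sup>2 * (\<omega> + 2)))\<rfloor>
         mod (\<omega> + 1) ^ nat (\<omega> * (\<omega> + 2)))\<rfloor>"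

end

theory Submission
  imports Defs "HOL-Library.Discrete_Functions" "HOL-Number_Theory.Cong"
begin

text \<open>
  The three expressions compute \<open>\<lfloor>\<surd>n\<rfloor>\<close>, its factorial, and a greatest common divisor.
  As \<open>p \<le> \<lfloor>\<surd>n\<rfloor> < q\<close>, the factorial \<open>\<lfloor>\<surd>n\<rfloor>!\<close> is divisible by \<open>p\<close> and not by \<open>q\<close>, so
  its greatest common divisor with \<open>n = p q\<close> is \<open>p\<close>.

  \<^item> Square root (\<open>omega_eq_floor_sqrt\<close>). Put \<open>x = n ^ (2 n)\<close>. Modulo \<open>x\<^sup>2 - n\<close> the integer \<open>x\<close> is
    a square root of \<open>n\<close>, and it is so large that the residue of \<open>(x + 1) ^ k\<close> is
    \<open>A + B x\<close>, where \<open>(1 + \<surd>n) ^ k = A + B \<surd>n\<close>. The quotient of the residues for \<open>2 n + 1\<close>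
    and \<open>2 n\<close> is therefore close to \<open>(A + B) / B = 1 + A / B\<close>, and \<open>A / B\<close> approximates
    \<open>\<surd>n\<close> so well that the floor is \<open>1 + \<lfloor>\<surd>n\<rfloor>\<close>.

  \<^item> Factorial (\<open>gamma_eq_fact\<close>). Put \<open>w = \<lfloor>\<surd>n\<rfloor>\<close>, \<open>R = (w + 1) ^ (w + 2)\<close> and \<open>T = R ^ w\<close>. The binomial
    coefficients \<open>R choose j\<close> with \<open>j \<le> w\<close> are less than \<open>T\<close>, so they are the low digits
    of \<open>(T + 1) ^ R\<close> in base \<open>T\<close>; the inner floor and remainder read off \<open>R choose w\<close>. It
    is slightly smaller than \<open>R ^ w / w!\<close>, so \<open>R ^ w / (R choose w)\<close> is slightly larger
    than \<open>w!\<close>.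

  \<^item> Greatest common divisor (\<open>gcd_eq_floor_mod\<close>). Write \<open>b\<close> for \<open>\<gamma> mod n\<close>.
    Expanded in geometric series, the last fraction is \<open>n ^ (n b - b)\<close> times \<open>\<Sum> c m / n ^ m\<close>, where \<open>c m\<close> counts the pairs
    \<open>(i, j)\<close> of naturals with \<open>n i + b j = m\<close>. Its last integral digit in base \<open>n\<close> is
    \<open>c (n b - b)\<close>, the number of \<open>j < n\<close> with \<open>n dvd b * j\<close>, which is \<open>gcd n b\<close>.
\<close>

section \<open>The integer square root\<close>

text \<open>
  The pair \<open>(a, b)\<close> with \<open>(1 + \<surd>n) ^ k = a + b \<surd>n\<close>, encoded without \<open>\<surd>n\<close> so that it is
  well defined and the facts below hold for perfect squares too.
\<close>

primrec surd_pow :: "int \<Rightarrow> nat \<Rightarrow> int \<times> int" where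
  "surd_pow n 0 = (1, 0)"
| "surd_pow n (Suc k) = (case surd_pow n k of (a, b) \<Rightarrow> (a + n * b, a + b))"

abbreviation surd_a :: "int \<Rightarrow> nat \<Rightarrow> int" where
  "surd_a n k \<equiv> fst (surd_pow n k)"

abbreviation surd_b :: "int \<Rightarrow> nat \<Rightarrow> int" where
  "surd_b n k \<equiv> snd (surd_pow n k)"

lemma surd_a_Suc: "surd_a n (Suc k) = surd_a n k + n * surd_b n k"
  and surd_b_Suc: "surd_b n (Suc k) = surd_a n k + surd_b n k"
  by (simp_all add: case_prod_beta)

declare surd_pow.simps(2) [simp del]

lemma surd_nonneg:
  assumes "n \<ge> 0"
  shows "surd_a n k \<ge> 0 \<and> surd_b n k \<ge> 0"
  using assms by (induction k) (auto simp: surd_a_Suc surd_b_Suc)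

text \<open>
  The norm is multiplicative, and that of \<open>1 + \<surd>n\<close> is \<open>1 - n\<close>. It measures how far
  \<open>a / b\<close> is from \<open>\<surd>n\<close>.
\<close>

lemma surd_norm: "(surd_a n k)\<^sup>2 - n * (surd_b n k)\<^sup>2 = (1 - n) ^ k"
proof (induction k)
  case (Suc k)
  have "(surd_a n (Suc k))\<^sup>2 - n * (surd_b n (Suc k))\<^sup>2
      = (1 - n) * ((surd_a n k)\<^sup>2 - n * (surd_b n k)\<^sup>2)"
    by (simp add: surd_a_Suc surd_b_Suc power2_eq_square algebra_simps)
  then show ?case by (simp only: Suc.IH power_Suc)
qed simp

text \<open>
  Modulo \<open>x\<^sup>2 - n\<close> the integer \<open>x\<close> plays the role of \<open>\<surd>n\<close>.
\<close>

lemma surd_cong: "[(x + 1) ^ k = surd_a n k + surd_b n k * x] (mod x\<^sup>2 - n)"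
proof (induction k)
  case (Suc k)
  have "[(x + 1) ^ Suc k = (x + 1) * (surd_a n k + surd_b n k * x)] (mod x\<^sup>2 - n)"
    using Suc.IH by (simp add: cong_scalar_left)
  also have "(x + 1) * (surd_a n k + surd_b n k * x)
      = surd_a n (Suc k) + surd_b n (Suc k) * x + surd_b n k * (x\<^sup>2 - n)"
    by (simp add: surd_a_Suc surd_b_Suc power2_eq_square algebra_simps)
  also have "[\<dots> = surd_a n (Suc k) + surd_b n (Suc k) * x] (mod x\<^sup>2 - n)"
    by (simp add: cong_def)
  finally show ?case .
qed simp

text \<open>
  If \<open>c\<close> is at least \<open>\<surd>n\<close>, then replacing \<open>\<surd>n\<close> by \<open>c\<close> can only increase the product at
  each step. This keeps \<open>a + b x\<close> below the modulus.
\<close>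

lemma surd_upper:
  assumes "n \<ge> 0" "c \<ge> 0" "n \<le> c\<^sup>2"
  shows "surd_a n k + c * surd_b n k \<le> (1 + c) ^ k"
proof (induction k)
  case (Suc k)
  have "n * surd_b n k \<le> c\<^sup>2 * surd_b n k"
    using assms surd_nonneg[of n k] by (intro mult_right_mono) auto
  then have "surd_a n (Suc k) + c * surd_b n (Suc k)
      \<le> (1 + c) * (surd_a n k + c * surd_b n k)"
    by (simp add: surd_a_Suc surd_b_Suc power2_eq_square algebra_simps)
  also have "\<dots> \<le> (1 + c) * (1 + c) ^ k"
    using assms Suc.IH by (intro mult_left_mono) auto
  finally show ?case by simp
qed simp

text \<open>
  These are the leading term of \<open>a\<close> and the leading term of \<open>b\<close> in the binomial expansion
  of \<open>(1 + \<surd>n) ^ (2 j)\<close>; the second bound is multiplied by \<open>n\<close> to avoid the exponent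
  \<open>j - 1\<close>. The factor \<open>2 j\<close> is what makes \<open>b\<close> exceed the square root of the norm.
\<close>

lemma surd_lower:
  assumes "n \<ge> 0"
  shows "n ^ j \<le> surd_a n (2 * j) \<and> 2 * int j * n ^ j \<le> n * surd_b n (2 * j)"
proof (induction j)
  case (Suc j)
  let ?a = "surd_a n (2 * j)" and ?b = "surd_b n (2 * j)"
  have nonneg: "?a \<ge> 0" "?b \<ge> 0" using surd_nonneg[OF assms] by auto
  have a: "surd_a n (2 * Suc j) = (1 + n) * ?a + 2 * n * ?b"
    and b: "surd_b n (2 * Suc j) = (1 + n) * ?b + 2 * ?a"
    by (simp_all add: surd_a_Suc surd_b_Suc algebra_simps)
  have "n * n ^ j \<le> n * ?a"
    using Suc.IH assms by (intro mult_left_mono) auto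
  moreover have "n * (2 * int j * n ^ j) \<le> n * (n * ?b)"
    using Suc.IH assms by (intro mult_left_mono) auto
  moreover have "0 \<le> n * ?b" using nonneg assms by simp
  ultimately show ?case
    unfolding a b using nonneg by (auto simp: algebra_simps)
qed simp

text \<open>
  The hypotheses on \<open>A\<close> and \<open>B\<close> say that \<open>A / B\<close> lies between \<open>\<surd>n\<close> and \<open>\<surd>(n + 1)\<close>, hence
  in the interval from \<open>m\<close> to \<open>m + 1\<close>, the right end excluded. The quotient minus one,
  \<open>(n B + A x) / (A + B x)\<close>, is a weighted mean of \<open>n B / A\<close> and \<open>A / B\<close>. The first of
  these is at most \<open>\<surd>n\<close>, hence below \<open>m + 1\<close>, and may lie below \<open>m\<close>; the lower bound
  uses that its weight is small, as \<open>n < x\<close>.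
\<close>

lemma quotient_eq_floor_sqrt:
  fixes A B m n x :: int
  assumes m: "0 \<le> m" "m\<^sup>2 \<le> n" "n < (m + 1)\<^sup>2"
    and B: "0 < B" and A: "0 \<le> A" "n * B\<^sup>2 \<le> A\<^sup>2" "A\<^sup>2 < (n + 1) * B\<^sup>2"
    and x: "n < x"
  shows "(A + n * B + (A + B) * x) div (A + B * x) = m + 1"
proof -
  have "(m * B)\<^sup>2 \<le> A\<^sup>2"
    using A(2) mult_right_mono[OF m(2), of "B\<^sup>2"] by (simp add: power_mult_distrib)
  then have mB: "m * B \<le> A" using A(1) by (rule power2_le_imp_le)
  have "(n + 1) * B\<^sup>2 \<le> (m + 1)\<^sup>2 * B\<^sup>2"
    using m(3) by (intro mult_right_mono) auto
  then have "A\<^sup>2 < ((m + 1) * B)\<^sup>2"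
    using A(3) by (simp add: power_mult_distrib)
  then have AB: "A < (m + 1) * B"
    by (rule power2_less_imp_less) (use m B in auto)
  have n0: "0 \<le> n" using m(2) zero_le_power2[of m] by linarith
  have "(n * B)\<^sup>2 = n * (n * B\<^sup>2)" by (simp add: power2_eq_square)
  also have "\<dots> \<le> n * A\<^sup>2" using n0 A(2) by (intro mult_left_mono)
  also have "\<dots> \<le> (m + 1)\<^sup>2 * A\<^sup>2" using m(3) by (intro mult_right_mono) auto
  finally have "(n * B)\<^sup>2 \<le> ((m + 1) * A)\<^sup>2" by (simp add: power_mult_distrib)
  then have nB: "n * B \<le> (m + 1) * A"
    by (rule power2_le_imp_le) (use m A in auto)
  have "m \<le> m\<^sup>2" using m(1) by (cases "m = 0") (auto simp: power2_eq_square)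
  then have mx: "m < x" using m(2) x by linarith
  have lower: "m * (A + B * x) \<le> n * B + A * x"
  proof -
    have "0 \<le> (A - m * B) * (x - m)" using mB mx by simp
    moreover have "0 \<le> (n - m\<^sup>2) * B" using m(2) B by simp
    ultimately show ?thesis by (simp add: power2_eq_square algebra_simps)
  qed
  have upper: "n * B + A * x < (m + 1) * (A + B * x)"
  proof -
    have "0 < ((m + 1) * B - A) * x" using AB mx m(1) by simp
    then show ?thesis using nB by (simp add: algebra_simps)
  qed
  have "A + n * B + (A + B) * x = (A + B * x) * (m + 1) + (n * B + A * x - m * (A + B * x))"
    by (simp add: algebra_simps)
  then show ?thesis
    by (rule int_div_pos_eq) (use lower upper in \<open>simp_all add: algebra_simps\<close>)
qed

text \<open>
  Here \<open>A\<^sup>2 - n B\<^sup>2 = (n - 1) ^ (2 n)\<close> and \<open>B \<ge> 2 n ^ n\<close>, which gives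
  \<open>n \<le> (A / B)\<^sup>2 < n + 1\<close>. The bound \<open>n \<ge> 6\<close> leaves room to show that the two residues
  need no reduction.
\<close>

theorem omega_eq_floor_sqrt:
  assumes "n \<ge> 6"
  shows "omega n = int (floor_sqrt n)"
proof -
  define N where "N = int n"
  define x where "x = N ^ (2 * n)"
  \<comment> \<open>Any \<open>c\<close> with \<open>\<surd>N \<le> c\<close> and \<open>\<surd>2 (1 + c) \<le> N\<close> would do; the second inequality gives
      \<open>(1 + c) ^ (2 n)\<close> a factor \<open>2 ^ n\<close> of room below \<open>x\<close>.\<close>
  define c where "c = N div 2"
  define m where "m = int (floor_sqrt n)"
  have N: "N \<ge> 6" using assms by (simp add: N_def)
  have c: "3 \<le> c" "2 * c \<le> N" "N \<le> 2 * c + 1" using N by (auto simp: c_def)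
  have cN: "N \<le> c\<^sup>2"
  proof -
    have "3 * c \<le> c * c" using c by (intro mult_right_mono) auto
    then show ?thesis unfolding power2_eq_square using c by linarith
  qed
  have "2 * (1 + c)\<^sup>2 \<le> N\<^sup>2"
  proof -
    have "(2 * (1 + c))\<^sup>2 \<le> (N + 2)\<^sup>2" using c by (intro power_mono) auto
    then have "4 * (1 + c)\<^sup>2 \<le> N\<^sup>2 + 4 * N + 4"
      by (simp add: power2_eq_square algebra_simps)
    moreover have "6 * N \<le> N\<^sup>2"
      unfolding power2_eq_square using N by (intro mult_right_mono) auto
    ultimately show ?thesis using N by linarith
  qed
  then have "(2 * (1 + c)\<^sup>2) ^ n \<le> (N\<^sup>2) ^ n" using c by (intro power_mono) auto
  then have pow: "2 ^ n * (1 + c) ^ (2 * n) \<le> x"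
    by (simp add: x_def power_mult_distrib power_mult)
  have two_n: "2 * N \<le> 2 ^ n"
  proof -
    have "2 * k \<le> 2 ^ k" if "k \<ge> 6" for k :: nat
      using that by (induction k rule: dec_induct) auto
    then show ?thesis unfolding N_def using assms
      by (metis of_nat_le_iff of_nat_mult of_nat_numeral of_nat_power)
  qed
  have small: "2 * (1 + c) ^ (2 * n + 1) \<le> x"
  proof -
    have "2 * (1 + c) ^ (2 * n + 1) = (2 * (1 + c)) * (1 + c) ^ (2 * n)" by simp
    also have "\<dots> \<le> 2 ^ n * (1 + c) ^ (2 * n)"
      using c N two_n by (intro mult_right_mono) auto
    finally show ?thesis using pow by simp
  qed
  have x: "N\<^sup>2 \<le> x" unfolding x_def using N assms by (intro power_increasing) auto
  have "6 * N \<le> N\<^sup>2" unfolding power2_eq_square using N by (intro mult_right_mono) auto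
  then have x6: "6 * N \<le> x" using x by linarith
  have residue: "(x + 1) ^ k mod (x\<^sup>2 - N) = surd_a N k + surd_b N k * x"
    if "k \<le> 2 * n + 1" for k
  proof -
    have nonneg: "surd_a N k \<ge> 0" "surd_b N k \<ge> 0" using surd_nonneg[of N k] N by auto
    have "surd_a N k + c * surd_b N k \<le> (1 + c) ^ k"
      using surd_upper cN N c by simp
    also have "\<dots> \<le> (1 + c) ^ (2 * n + 1)" using that c by (intro power_increasing) auto
    finally have "2 * (surd_a N k + c * surd_b N k) \<le> 2 * (1 + c) ^ (2 * n + 1)" by simp
    then have "2 * (surd_a N k + c * surd_b N k) \<le> x" using small by (rule order_trans)
    then have *: "2 * surd_a N k + 2 * (c * surd_b N k) \<le> x" by (simp only: distrib_left)
    have b: "surd_b N k \<le> c * surd_b N k" using nonneg c mult_right_mono[of 1 c "surd_b N k"] by simp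
    have a: "2 * surd_a N k \<le> x" using * nonneg b by linarith
    have "2 * surd_b N k \<le> x" using * nonneg b by linarith
    then have "2 * surd_b N k * x \<le> x * x" using x6 N by (intro mult_right_mono) auto
    then have "2 * (surd_b N k * x) \<le> x\<^sup>2" by (simp only: power2_eq_square mult.assoc)
    moreover have "6 * x \<le> x\<^sup>2"
      unfolding power2_eq_square using x6 N by (intro mult_right_mono) auto
    ultimately have "surd_a N k + surd_b N k * x < x\<^sup>2 - N"
      using a x6 N by linarith
    moreover have "0 \<le> surd_a N k + surd_b N k * x" using nonneg x6 N by simp
    ultimately show ?thesis using surd_cong[of x k N] by (simp add: cong_def)
  qed
  define A where "A = surd_a N (2 * n)"
  define B where "B = surd_b N (2 * n)"
  have A0: "0 \<le> A" unfolding A_def using surd_nonneg N by simp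
  have B_large: "N ^ n < B"
  proof -
    have "2 * N * N ^ n \<le> N * B" using surd_lower[of N n] N by (simp add: N_def B_def)
    then have "2 * N ^ n \<le> B" using N by simp
    moreover have "0 < N ^ n" using N by simp
    ultimately show ?thesis by linarith
  qed
  have "A\<^sup>2 - N * B\<^sup>2 = (1 - N) ^ (2 * n)" unfolding A_def B_def by (rule surd_norm)
  also have "\<dots> = ((1 - N)\<^sup>2) ^ n" by (rule power_mult)
  also have "(1 - N)\<^sup>2 = (N - 1)\<^sup>2" by (rule power2_commute)
  also have "((N - 1)\<^sup>2) ^ n = ((N - 1) ^ n)\<^sup>2" by (simp only: power_mult [symmetric] mult.commute)
  finally have norm: "A\<^sup>2 - N * B\<^sup>2 = ((N - 1) ^ n)\<^sup>2" .
  have "((N - 1) ^ n)\<^sup>2 < B\<^sup>2"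
  proof (rule power_strict_mono)
    have "(N - 1) ^ n \<le> N ^ n" using N by (intro power_mono) auto
    then show "(N - 1) ^ n < B" using B_large by simp
  qed (use N in auto)
  then have A_lt: "A\<^sup>2 < (N + 1) * B\<^sup>2" using norm by (simp add: algebra_simps)
  have A_ge: "N * B\<^sup>2 \<le> A\<^sup>2" using norm zero_le_power2[of "(N - 1) ^ n"] by linarith
  have B0: "0 < B" using B_large N zero_le_power[of N n] by linarith
  have m: "0 \<le> m" "m\<^sup>2 \<le> N" "N < (m + 1)\<^sup>2"
  proof -
    have "int ((floor_sqrt n)\<^sup>2) \<le> int n" by (simp only: of_nat_le_iff floor_sqrt_power2_le)
    then show "m\<^sup>2 \<le> N" by (simp add: m_def N_def)
    have "int n < int ((Suc (floor_sqrt n))\<^sup>2)"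
      by (simp only: of_nat_less_iff Suc_floor_sqrt_power2_gt)
    then show "N < (m + 1)\<^sup>2" by (simp add: m_def N_def add.commute)
  qed (simp add: m_def)
  have "omega n = (x + 1) ^ (2 * n + 1) mod (x\<^sup>2 - N) div ((x + 1) ^ (2 * n) mod (x\<^sup>2 - N)) - 1"
    unfolding omega_def floor_divide_of_int_eq
    by (simp add: x_def N_def mult.commute flip: power_mult)
  also have "\<dots> = (A + N * B + (A + B) * x) div (A + B * x) - 1"
    using residue[of "2 * n"] residue[of "2 * n + 1"]
    by (simp add: A_def B_def surd_a_Suc surd_b_Suc)
  also have "\<dots> = m"
    using quotient_eq_floor_sqrt[OF m B0 A0 A_ge A_lt] x6 N by simp
  finally show ?thesis by (simp add: m_def)
qed


section \<open>The factorial\<close>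

text \<open>
  Only the digits up to position \<open>k\<close> have to be smaller than the base: higher coefficients
  contribute multiples of \<open>T ^ (k + 1)\<close>. This matters below, as the middle binomial
  coefficients exceed the base.
\<close>

lemma digit_of_sum:
  fixes c :: "nat \<Rightarrow> nat"
  assumes "k \<le> r" and "\<And>j. j \<le> k \<Longrightarrow> c j < T"
  shows "(\<Sum>j\<le>r. c j * T ^ j) div T ^ k mod T = c k"
  using assms
proof (induction k arbitrary: c r)
  case 0
  show ?case
  proof (cases r)
    case (Suc s)
    have "(\<Sum>j\<le>r. c j * T ^ j) = c 0 + T * (\<Sum>j\<le>s. c (Suc j) * T ^ j)"
      by (simp only: Suc sum.atMost_Suc_shift sum_distrib_left power_0 power_Suc
          mult_1_right mult.left_commute)
    then show ?thesis using 0 by simp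
  qed (use 0 in simp)
next
  case (Suc k)
  then obtain s where r: "r = Suc s" by (cases r) auto
  have shift: "(\<Sum>j\<le>r. c j * T ^ j) = c 0 + T * (\<Sum>j\<le>s. c (Suc j) * T ^ j)"
    by (simp only: r sum.atMost_Suc_shift sum_distrib_left power_0 power_Suc
        mult_1_right mult.left_commute)
  have c0: "c 0 < T" using Suc.prems by simp
  have "(\<Sum>j\<le>r. c j * T ^ j) div T ^ Suc k mod T
      = (\<Sum>j\<le>r. c j * T ^ j) div T div T ^ k mod T"
    by (simp only: power_Suc div_mult2_eq)
  also have "(\<Sum>j\<le>r. c j * T ^ j) div T = (\<Sum>j\<le>s. c (Suc j) * T ^ j)"
    unfolding shift using c0 by simp
  also have "\<dots> div T ^ k mod T = c (Suc k)"
    using Suc.prems r by (intro Suc.IH) auto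
  finally show ?case .
qed

lemma binomial_as_digit:
  fixes r k T :: nat
  assumes "k \<le> r" and "\<And>j. j \<le> k \<Longrightarrow> r choose j < T"
  shows "(T + 1) ^ r div T ^ k mod T = r choose k"
proof -
  have "(T + 1) ^ r = (\<Sum>j\<le>r. (r choose j) * T ^ j)"
    using binomial[of T 1 r] by simp
  then show ?thesis using digit_of_sum[OF assms] by simp
qed

text \<open>
  The right-hand side is the falling factorial \<open>r (r - 1) \<dots> (r - k + 1)\<close>.
\<close>

lemma fact_mult_binomial_ge:
  fixes r w :: nat
  assumes "k \<le> w" "w \<le> r"
  shows "(r - w) ^ k \<le> fact k * (r choose k)"
  using assms(1)
proof (induction k)
  case (Suc k)
  have "(r - w) ^ Suc k \<le> (r - k) * (fact k * (r choose k))"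
    using Suc by (auto intro: mult_mono)
  also have "\<dots> = fact (Suc k) * (r choose Suc k)"
  proof -
    have "(r - k) * (r choose k) = Suc k * (r choose Suc k)"
      by (simp only: binomial_absorb_comp binomial_absorption)
    then have "fact k * ((r - k) * (r choose k)) = fact k * (Suc k * (r choose Suc k))"
      by (simp only:)
    then show ?thesis by (simp only: fact_Suc mult_ac of_nat_id)
  qed
  finally show ?case .
qed simp

text \<open>
  The falling factorial \<open>w! (r choose w)\<close> lies between \<open>(r - w) ^ w\<close> and \<open>r ^ w\<close>. By
  Bernoulli's inequality the former is at least \<open>r ^ w (1 - w\<^sup>2 / r)\<close>, so the quotient
  exceeds \<open>w!\<close> by a factor of at most \<open>1 / (1 - w\<^sup>2 / r)\<close>. The bound on \<open>r\<close> says that this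
  factor is less than \<open>1 + 1 / w!\<close>.
\<close>

lemma fact_eq_power_div_binomial:
  fixes r w :: nat
  assumes "2 \<le> w" and r: "w\<^sup>2 * (fact w + 1) < r"
  shows "r ^ w div (r choose w) = fact w"
proof -
  have "w * 1 \<le> w\<^sup>2 * (fact w + 1)" unfolding power2_eq_square by (intro mult_mono) auto
  then have wr: "w \<le> r" using r by linarith
  define C where "C = int (r choose w)"
  define R where "R = int r"
  define f where "f = (fact w :: int)"
  have C: "0 < C" using wr by (simp add: C_def)
  have upper: "f * C \<le> R ^ w"
    using binomial_fact_pow[of r w] unfolding C_def R_def f_def
    by (metis mult.commute of_nat_fact of_nat_le_iff of_nat_mult of_nat_power)
  obtain v where v: "w = Suc v" using assms(1) by (cases w) auto
  have "R ^ w - int w ^ 2 * R ^ v \<le> (R - int w) ^ w"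
  proof -
    have R0: "R > 0" using wr assms by (simp add: R_def)
    have "1 + real w * (- (real w / real r)) \<le> (1 + - (real w / real r)) ^ w"
      by (rule Bernoulli_inequality) (use wr assms in \<open>simp add: field_simps\<close>)
    then have "real r ^ w * (1 - real w * (real w / real r))
        \<le> real r ^ w * (1 - real w / real r) ^ w"
      by (intro mult_left_mono) auto
    also have "\<dots> = (real r - real w) ^ w"
      using R0 by (simp add: R_def field_simps flip: power_mult_distrib)
    also have "real r ^ w * (1 - real w * (real w / real r)) = real r ^ w - real w ^ 2 * real r ^ v"
      using R0 by (simp add: R_def v field_simps power2_eq_square)
    finally have "real_of_int (R ^ w - int w ^ 2 * R ^ v) \<le> real_of_int ((R - int w) ^ w)"
      by (simp add: R_def)
    then show ?thesis by (simp only: of_int_le_iff)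
  qed
  also have "\<dots> \<le> f * C"
  proof -
    have "int ((r - w) ^ w) \<le> int (fact w * (r choose w))"
      using fact_mult_binomial_ge[of w w r] wr by (simp only: of_nat_le_iff)
    then show ?thesis using wr by (simp add: f_def C_def R_def of_nat_diff)
  qed
  finally have lower: "R ^ w - int w ^ 2 * R ^ v \<le> f * C" .
  have f0: "f > 0" by (simp add: f_def)
  have "int (w\<^sup>2 * (fact w + 1)) < int r" using r by (simp only: of_nat_less_iff)
  then have "int w ^ 2 * (f + 1) < R" by (simp add: f_def R_def algebra_simps)
  then have "int w ^ 2 * (f + 1) * R ^ v < R * R ^ v"
    using wr assms by (intro mult_strict_right_mono) (auto simp: R_def)
  then have "(f + 1) * (int w ^ 2 * R ^ v) < R ^ w"
    by (simp add: v mult_ac)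
  moreover have "(f + 1) * (R ^ w - int w ^ 2 * R ^ v) \<le> (f + 1) * (f * C)"
    using lower f0 by (intro mult_left_mono) auto
  ultimately have "f * R ^ w < f * ((f + 1) * C)"
    by (simp add: algebra_simps)
  then have "R ^ w < (f + 1) * C" using f0 by simp
  then have "R ^ w div C = f"
    using upper C by (intro int_div_pos_eq[where r = "R ^ w - f * C"]) (auto simp: algebra_simps)
  then have "int (r ^ w div (r choose w)) = int (fact w)"
    by (simp add: R_def C_def f_def zdiv_int)
  then show ?thesis by (simp only: of_nat_eq_iff)
qed

text \<open>
  The value \<open>w = 1\<close> must be excluded: then \<open>R = T\<close>, and the digit \<open>R choose 1\<close> is reduced
  to \<open>0\<close>. For \<open>w \<ge> 2\<close> the divisor \<open>w! \<ge> 2\<close> keeps \<open>R choose w\<close> below \<open>T = R ^ w\<close>.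
\<close>

theorem gamma_eq_fact:
  assumes "2 \<le> w"
  shows "gamma (int w) = fact w"
proof -
  define R where "R = (w + 1) ^ (w + 2)"
  define T where "T = R ^ w"
  have T: "T = (w + 1) ^ (w * (w + 2))"
    unfolding T_def R_def by (simp only: power_mult [symmetric] mult.commute)
  have Tw: "T ^ w = (w + 1) ^ (w\<^sup>2 * (w + 2))"
    unfolding T by (simp only: power_mult [symmetric] power2_eq_square mult_ac)
  have R_large: "w\<^sup>2 * (fact w + 1) < R"
  proof -
    obtain v where v: "w = Suc v" using assms by (cases w) auto
    have "fact w + 1 \<le> w ^ w + (1 :: nat)" using fact_le_power[of w, where ?'a = nat] by simp
    also have "w ^ w + 1 \<le> (w + 1) ^ w"
    proof -
      have "w ^ w + 1 \<le> (w + 1) * w ^ v" unfolding v by simp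
      also have "\<dots> \<le> (w + 1) * (w + 1) ^ v" by (intro mult_left_mono power_mono) auto
      finally show ?thesis by (simp add: v)
    qed
    finally have "w\<^sup>2 * (fact w + 1) \<le> w\<^sup>2 * (w + 1) ^ w" by (rule mult_left_mono) simp
    also have "\<dots> < (w + 1)\<^sup>2 * (w + 1) ^ w"
      by (intro mult_strict_right_mono power_strict_mono) auto
    finally show ?thesis unfolding R_def by (simp only: power_add mult.commute)
  qed
  have "w * 1 \<le> w\<^sup>2 * (fact w + 1)" unfolding power2_eq_square by (intro mult_mono) auto
  then have wR: "w < R" using R_large by linarith
  have choose_lt: "R choose j < T" if "j \<le> w" for j
  proof (cases "j < w")
    case True
    have "R choose j \<le> R ^ j" using that wR by (simp add: binomial_le_pow)
    also have "\<dots> < R ^ w" using True wR assms by (intro power_strict_increasing) auto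
    finally show ?thesis by (simp add: T_def)
  next
    case False
    then have j: "j = w" using that by simp
    have "2 * (R choose w) \<le> fact w * (R choose w)"
      using assms fact_ge_self[of w] by (intro mult_right_mono) auto
    also have "\<dots> \<le> T" using binomial_fact_pow[of R w] by (simp add: T_def mult.commute)
    finally have "2 * (R choose w) \<le> T" .
    moreover have "0 < R choose w" using wR by (simp add: zero_less_binomial)
    ultimately show ?thesis unfolding j by linarith
  qed
  have digit: "(T + 1) ^ R div T ^ w mod T = R choose w"
    using binomial_as_digit[OF less_imp_le[OF wR] choose_lt] by simp
  have e1: "nat (int w * (int w + 2)) = w * (w + 2)"
    by (metis nat_int of_nat_add of_nat_mult of_nat_numeral)
  have e2: "nat ((int w)\<^sup>2 * (int w + 2)) = w\<^sup>2 * (w + 2)"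
    by (metis nat_int of_nat_add of_nat_mult of_nat_numeral of_nat_power)
  have e3: "nat (int w + 2) = w + 2" by simp
  have e4: "nat ((int w + 1) ^ (w + 2)) = R"
    unfolding R_def by (metis nat_int of_nat_1 of_nat_add of_nat_power)
  have e5: "(int w + 1) ^ (w * (w + 2)) = int T" by (simp add: T add.commute)
  have e6: "(int w + 1) ^ (w\<^sup>2 * (w + 2)) = int (T ^ w)" by (simp only: Tw of_nat_power of_nat_add of_nat_1)
  have "gamma (int w) = int T div ((int T + 1) ^ R div int (T ^ w) mod int T)"
    unfolding gamma_def floor_divide_of_int_eq e1 e2 e3 e4 e5 e6 ..
  also have "\<dots> = int (T div ((T + 1) ^ R div T ^ w mod T))"
    by (simp add: zdiv_int zmod_int add.commute)
  also have "\<dots> = fact w"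
    unfolding digit unfolding T_def fact_eq_power_div_binomial[OF assms R_large] by simp
  finally show ?thesis .
qed


section \<open>The greatest common divisor\<close>

text \<open>
  Divide by \<open>d = gcd n b\<close>: as \<open>n / d\<close> and \<open>b / d\<close> are coprime, the condition says that
  \<open>j\<close> is a multiple of \<open>n / d\<close>.
\<close>

lemma card_multiples_mod:
  fixes n b :: nat
  assumes "n > 0"
  shows "card {j. j < n \<and> n dvd b * j} = gcd n b"
proof -
  define d where "d = gcd n b"
  have d: "d > 0" using assms by (simp add: d_def)
  obtain n' b' where nb: "n = d * n'" "b = d * b'" "coprime n' b'"
    unfolding d_def using gcd_coprime_exists[of n b] assms by (metis gcd_pos_nat mult.commute neq0_conv)
  have "n dvd b * j \<longleftrightarrow> n' dvd j" for j
    using d nb(3) unfolding nb(1,2) by (simp add: mult.assoc coprime_dvd_mult_right_iff)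
  then have "{j. j < n \<and> n dvd b * j} = (\<lambda>k. n' * k) ` {..<d}"
    using assms unfolding nb(1) by (auto simp: dvd_def mult.commute)
  moreover have "inj_on (\<lambda>k. n' * k) {..<d}"
    using assms nb(1) by (auto simp: inj_on_def)
  ultimately show ?thesis by (simp add: card_image d_def)
qed

text \<open>
  Division of \<open>N ^ (a + s)\<close> by \<open>N ^ a - 1\<close> with quotient and remainder. For \<open>N > 1\<close> and
  \<open>a > 0\<close> the quotient is divisible by \<open>N\<close> unless \<open>a\<close> divides \<open>s\<close>; in that case it is
  \<open>1\<close> modulo \<open>N\<close>.
\<close>

lemma geometric_term:
  fixes N :: int and a s :: nat
  shows "(N ^ a - 1) * (N ^ (s mod a) * (\<Sum>i\<le>s div a. (N ^ a) ^ i))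
       = N ^ (a + s) - N ^ (s mod a)"
proof -
  have "(N ^ a - 1) * (\<Sum>i\<le>s div a. (N ^ a) ^ i) = (N ^ a) ^ Suc (s div a) - 1"
    by (metis lessThan_Suc_atMost power_diff_1_eq)
  then have "(N ^ a - 1) * (N ^ (s mod a) * (\<Sum>i\<le>s div a. (N ^ a) ^ i))
       = N ^ (s mod a) * ((N ^ a) ^ Suc (s div a) - 1)"
    by (simp only: mult.left_commute [of "N ^ a - 1"])
  also have "\<dots> = N ^ (s mod a) * (N ^ a) ^ Suc (s div a) - N ^ (s mod a)"
    by (simp only: right_diff_distrib mult_1_right)
  also have "N ^ (s mod a) * (N ^ a) ^ Suc (s div a) = N ^ (a + s)"
    by (simp add: add.commute flip: power_mult power_add)
  finally show ?thesis .
qed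

text \<open>
  Write \<open>N\<close> for \<open>n\<close> as a base, \<open>P = N ^ n - 1\<close> and \<open>Q = N ^ b - 1\<close>. A geometric sum gives
  \<open>N ^ (n b) = Q S + 1\<close> with \<open>S = \<Sum>j<n. N ^ (b j)\<close>, and dividing each term of \<open>N ^ n S\<close> by
  \<open>P\<close> as in \<open>geometric_term\<close> gives quotients \<open>U j\<close> and a total remainder \<open>E\<close>. Modulo
  \<open>N\<close> the sum of the \<open>U j\<close> counts the \<open>j < n\<close> with \<open>n dvd b * j\<close>.

  It remains to see that \<open>E Q + N ^ n < P Q\<close>. The exponents in \<open>E\<close> are multiples of
  \<open>gcd n b \<ge> 2\<close> below \<open>n\<close>, hence at most \<open>n - 2\<close>, so that \<open>E \<le> n N ^ (n - 2) = N ^ (n - 1)\<close>.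
  The last equality is where the base being \<open>n\<close> itself is used. The case \<open>n = b = 2\<close> has to
  be excluded, since \<open>\<lfloor>64 / 9\<rfloor> = 7\<close> is odd.
\<close>

theorem gcd_eq_floor_mod:
  fixes n b :: nat
  assumes n: "3 \<le> n" and b: "0 < b" and d: "2 \<le> gcd n b"
  shows "int n ^ (n + n * b) div ((int n ^ n - 1) * (int n ^ b - 1)) mod int n
       = int (gcd n b) mod int n"
proof -
  define N where "N = int n"
  define P where "P = N ^ n - 1"
  define Q where "Q = N ^ b - 1"
  define U where "U j = N ^ (b * j mod n) * (\<Sum>i\<le>b * j div n. (N ^ n) ^ i)" for j
  define E where "E = (\<Sum>j<n. N ^ (b * j mod n))"
  have N: "N \<ge> 3" using n by (simp add: N_def)
  have b2: "2 \<le> b" using d b gcd_le2_nat[of b n] by linarith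
  have PU: "P * (\<Sum>j<n. U j) = N ^ n * (\<Sum>j<n. (N ^ b) ^ j) - E"
    using geometric_term[of N n]
    by (simp add: P_def U_def E_def sum_distrib_left sum_subtractf power_add flip: power_mult)
  have "Q * (\<Sum>j<n. (N ^ b) ^ j) = N ^ (n * b) - 1"
    unfolding Q_def by (metis power_diff_1_eq mult.commute power_mult)
  then have "N ^ (n + n * b) = N ^ n * (Q * (\<Sum>j<n. (N ^ b) ^ j) + 1)"
    by (simp add: power_add)
  also have "\<dots> = Q * (P * (\<Sum>j<n. U j) + E) + N ^ n"
    unfolding PU by (simp add: algebra_simps)
  finally have split: "N ^ (n + n * b) = (\<Sum>j<n. U j) * (P * Q) + (E * Q + N ^ n)"
    by (simp add: algebra_simps)
  have E0: "0 \<le> E" unfolding E_def using N by (intro sum_nonneg) auto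
  have E_le: "E \<le> N ^ (n - 1)"
  proof -
    \<comment> \<open>A remainder \<open>n - 1\<close> would make \<open>gcd n b\<close> divide \<open>1\<close>.\<close>
    have r: "b * j mod n \<le> n - 2" for j
    proof -
      have "gcd n b dvd n - b * j mod n"
        by (intro dvd_diff_nat) (simp_all add: dvd_mod_iff)
      moreover have "b * j mod n < n" using n by simp
      ultimately show ?thesis using d dvd_imp_le[of "gcd n b" "n - b * j mod n"] by simp
    qed
    have "E \<le> (\<Sum>j<n. N ^ (n - 2))"
      unfolding E_def using N r by (intro sum_mono power_increasing) auto
    also have "\<dots> = N ^ Suc (n - 2)" by (simp add: N_def)
    also have "Suc (n - 2) = n - 1" using n by simp
    finally show ?thesis .
  qed
  have "N\<^sup>2 \<le> N ^ b" using N b2 by (intro power_increasing) auto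
  then have Q: "N\<^sup>2 - 1 \<le> Q" unfolding Q_def by linarith
  have NN: "3 * N \<le> N\<^sup>2" using N mult_right_mono[of 3 N N] by (simp add: power2_eq_square)
  define X where "X = N ^ (n - 1)"
  have X: "1 \<le> X" unfolding X_def using N by simp
  have Nn: "N ^ n = N * X" unfolding X_def using n by (cases n) auto
  have rem: "E * Q + N ^ n < P * Q"
  proof -
    have "E * Q \<le> X * Q" using E_le Q NN N by (intro mult_right_mono) (auto simp: X_def)
    moreover have "N * X < Q * X" using X Q NN N by (intro mult_strict_right_mono) linarith+
    moreover have "Q * X \<le> Q * ((N - 1) * X - 1)"
    proof (rule mult_left_mono)
      have "2 * X \<le> (N - 1) * X" using N X by (intro mult_right_mono) auto
      then show "X \<le> (N - 1) * X - 1" using X by linarith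
    qed (use Q NN N in linarith)
    ultimately show ?thesis unfolding P_def Nn by (simp add: algebra_simps)
  qed
  have "0 < Q" using Q NN N by linarith
  then have "0 \<le> E * Q + N ^ n" using E0 N by simp
  then have "N ^ (n + n * b) div (P * Q) = (\<Sum>j<n. U j)"
    using split rem by (intro int_div_pos_eq[where r = "E * Q + N ^ n"]) (auto simp: mult.commute)
  moreover have "(\<Sum>j<n. U j) mod N = int (gcd n b) mod N"
  proof -
    have U: "[U j = (if n dvd b * j then 1 else 0)] (mod N)" for j
    proof (cases "n dvd b * j")
      case True
      have "[(\<Sum>i\<le>b * j div n. (N ^ n) ^ i) = (\<Sum>i\<le>b * j div n. if i = 0 then 1 else 0)] (mod N)"
      proof (intro cong_sum)
        fix i
        have "N dvd (N ^ n) ^ i" if "0 < i"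
          using dvd_power[of "n * i" N] n that by (simp add: power_mult)
        then show "[(N ^ n) ^ i = (if i = 0 then 1 else 0)] (mod N)"
          by (simp add: cong_0_iff)
      qed
      then show ?thesis using True by (simp add: U_def dvd_eq_mod_eq_0)
    next
      case False
      then have "0 < b * j mod n" by (simp add: mod_greater_zero_iff_not_dvd)
      then have "N dvd U j" unfolding U_def by (intro dvd_mult2 dvd_power) auto
      then show ?thesis using False by (simp add: cong_0_iff)
    qed
    have "[(\<Sum>j<n. U j) = (\<Sum>j<n. if n dvd b * j then 1 else 0)] (mod N)"
      by (intro cong_sum U)
    also have "(\<Sum>j<n. if n dvd b * j then 1 else 0 :: int) = int (card {j. j < n \<and> n dvd b * j})"
      by (simp add: sum.If_cases Int_def lessThan_def)
    also have "\<dots> = int (gcd n b)" using n by (simp add: card_multiples_mod)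
    finally show ?thesis by (simp add: cong_def)
  qed
  ultimately show ?thesis by (simp add: N_def P_def Q_def)
qed

section \<open>The smaller prime factor\<close>

lemma gcd_semiprime_fact:
  fixes p q w :: nat
  assumes "prime p" "prime q" "p \<le> w" "w < q"
  shows "gcd (p * q) (fact w) = p"
proof -
  have "p dvd fact w" using assms by (simp add: prime_dvd_fact_iff)
  then obtain f where f: "fact w = p * f" by blast
  have "\<not> q dvd fact w" using assms by (simp add: prime_dvd_fact_iff)
  then have "\<not> q dvd f" unfolding f by auto
  then have "coprime q f" using assms(2) by (simp add: prime_imp_coprime)
  then show ?thesis unfolding f by (simp add: gcd_mult_distrib_nat[symmetric])
qed

theorem theorem10:
  fixes n p q :: nat and \<omega> \<gamma> :: int
  assumes "prime p" and "prime q" and "p < q" and "n = p * q"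
    and "\<omega> = omega n" and "\<gamma> = gamma \<omega>"
  shows "int p =
    \<lfloor>rat_of_int (int n ^ (n + n * nat (\<gamma> mod int n))) /
     rat_of_int ((int n ^ n - 1) * (int n ^ nat (\<gamma> mod int n) - 1))\<rfloor> mod int n"
proof -
  define w where "w = floor_sqrt n"
  have p2: "2 \<le> p" using assms(1) by (rule prime_ge_2_nat)
  have "2 * 3 \<le> p * q" using p2 assms(3) by (intro mult_mono) auto
  then have n6: "6 \<le> n" using assms(4) by simp
  have "p\<^sup>2 \<le> n" using assms(3,4) by (simp add: power2_eq_square)
  then have pw: "p \<le> w" unfolding w_def by (simp add: le_floor_sqrt_iff)
  have "n < q\<^sup>2" using assms(3,4) by (simp add: power2_eq_square)
  then have wq: "w < q" unfolding w_def
    by (meson le_floor_sqrt_iff not_le)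
  have gamma: "\<gamma> = int (fact w)"
    using gamma_eq_fact[of w] omega_eq_floor_sqrt[OF n6] p2 pw assms(5,6) by (simp add: w_def)
  define g where "g = fact w mod n"
  have g: "nat (\<gamma> mod int n) = g"
    unfolding gamma g_def by (metis nat_int zmod_int)
  have gcd_g: "gcd n g = p"
    unfolding g_def using gcd_semiprime_fact[OF assms(1,2) pw wq] assms(4)
    by (metis gcd.commute gcd_red_nat)
  \<comment> \<open>The remainder \<open>g\<close> is not \<open>0\<close>, as \<open>gcd n 0 = n\<close>.\<close>
  have "p < n" using assms(3,4) p2 by simp
  then have "0 < g" using gcd_g by (cases "g = 0") auto
  then show ?thesis
    unfolding floor_divide_of_int_eq g
    using gcd_eq_floor_mod[of n g] gcd_g p2 n6 \<open>p < n\<close> by simp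
qed

end
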